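(* The square root of the Kullback–Leibler divergence between Cauchy densities is isometrically embeddable into a Hilbert space: there exist a Hilbert space $\mathcal{H}$ and a map $\phi:\mathbb{H}\to\mathcal{H}$ such that $\sqrt{D_{\mathrm{KL}}(p_z:p_w)}=\|\phi(z)-\phi(w)\|_{\mathcal{H}}$ for all $z,w\in\mathbb{H}$.
   Context: $\mathbb{H}=\{z\in\mathbb{C}:\operatorname{Im}z>0\}$ is the upper half-plane. For $z\in\mathbb{H}$, $p_z(x)=\frac{\operatorname{Im}z}{\pi|x-z|^2}$, $x\in\mathbb{R}$, is the Cauchy density. $D_{\mathrm{KL}}(p:q)=\int_{\mathbb{R}}p(x)\log\frac{p(x)}{q(x)}\,dx$. *)

theory Defs
  imports "HOL-Probability.Probability"
begin

definition upper_half_plane :: "complex set" where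
  "upper_half_plane = {z. Im z > 0}"

definition cauchy_density :: "complex \<Rightarrow> real \<Rightarrow> real" where
  "cauchy_density z x = Im z / (pi * (cmod (of_real x - z))\<^sup>2)"

definition kl_div :: "(real \<Rightarrow> real) \<Rightarrow> (real \<Rightarrow> real) \<Rightarrow> real" where
  "kl_div p q = (LINT x|lborel. p x * ln (p x / q x))"

text \<open>The library's \<open>KL_divergence\<close> takes measures, and its arguments are in the opposite order.\<close>

lemma kl_div_eq_KL_divergence:
  assumes "p \<in> borel_measurable lborel" "q \<in> borel_measurable lborel"
    and "\<And>x. 0 < p x" "\<And>x. 0 < q x"
  shows "kl_div p q = KL_divergence (exp 1) (density lborel q) (density lborel p)"
  using assms
  by (subst lborel.KL_density_density)
     (auto simp: kl_div_def log_def less_imp_le less_imp_neq[THEN not_sym])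

definition hilbert_norm :: "('a \<Rightarrow> 'a \<Rightarrow> real) \<Rightarrow> 'a \<Rightarrow> real" where
  "hilbert_norm ip x = sqrt (ip x x)"

definition hilbert_diff :: "('a \<Rightarrow> 'a \<Rightarrow> 'a) \<Rightarrow> (real \<Rightarrow> 'a \<Rightarrow> 'a) \<Rightarrow> 'a \<Rightarrow> 'a \<Rightarrow> 'a" where
  "hilbert_diff add scl x y = add x (scl (- 1) y)"

text \<open>
  Type classes cannot express ``there exists a Hilbert space'', since types cannot be quantified
  existentially. Hence a real Hilbert space is given here by a carrier set with explicit operations,
  which are only constrained on the carrier.
\<close>

locale real_hilbert_space =
  fixes H :: "'a set"
    and zero :: 'a
    and add :: "'a \<Rightarrow> 'a \<Rightarrow> 'a"
    and scl :: "real \<Rightarrow> 'a \<Rightarrow> 'a"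
    and ip :: "'a \<Rightarrow> 'a \<Rightarrow> real"
  assumes zero_closed: "zero \<in> H"
    and add_closed: "\<lbrakk>x \<in> H; y \<in> H\<rbrakk> \<Longrightarrow> add x y \<in> H"
    and scl_closed: "x \<in> H \<Longrightarrow> scl a x \<in> H"
    and add_assoc: "\<lbrakk>x \<in> H; y \<in> H; z \<in> H\<rbrakk> \<Longrightarrow> add (add x y) z = add x (add y z)"
    and add_commute: "\<lbrakk>x \<in> H; y \<in> H\<rbrakk> \<Longrightarrow> add x y = add y x"
    and add_zero: "x \<in> H \<Longrightarrow> add x zero = x"
    and add_neg: "x \<in> H \<Longrightarrow> add x (scl (- 1) x) = zero"
    and scl_add_right: "\<lbrakk>x \<in> H; y \<in> H\<rbrakk> \<Longrightarrow> scl a (add x y) = add (scl a x) (scl a y)"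
    and scl_add_left: "x \<in> H \<Longrightarrow> scl (a + b) x = add (scl a x) (scl b x)"
    and scl_scl: "x \<in> H \<Longrightarrow> scl a (scl b x) = scl (a * b) x"
    and scl_one: "x \<in> H \<Longrightarrow> scl 1 x = x"
    and ip_commute: "\<lbrakk>x \<in> H; y \<in> H\<rbrakk> \<Longrightarrow> ip x y = ip y x"
    and ip_add_left: "\<lbrakk>x \<in> H; y \<in> H; z \<in> H\<rbrakk> \<Longrightarrow> ip (add x y) z = ip x z + ip y z"
    and ip_scl_left: "\<lbrakk>x \<in> H; y \<in> H\<rbrakk> \<Longrightarrow> ip (scl a x) y = a * ip x y"
    and ip_nonneg: "x \<in> H \<Longrightarrow> 0 \<le> ip x x"
    and ip_eq_zero: "\<lbrakk>x \<in> H; ip x x = 0\<rbrakk> \<Longrightarrow> x = zero"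
    and complete: "\<lbrakk>\<And>n. s n \<in> H;
        \<And>e. e > 0 \<Longrightarrow> \<exists>N. \<forall>m\<ge>N. \<forall>n\<ge>N. hilbert_norm ip (hilbert_diff add scl (s m) (s n)) < e\<rbrakk>
      \<Longrightarrow> \<exists>x\<in>H. (\<lambda>n. hilbert_norm ip (hilbert_diff add scl (s n) x)) \<longlonglongrightarrow> 0"

text \<open>
  The existential needs a fixed ambient type for the elements of the Hilbert space. Taking
  \<open>nat \<Rightarrow> complex\<close>, a type with the cardinality of the continuum, is no restriction: the
  closed linear span of the image of \<open>\<phi>\<close> is again a Hilbert space, it has at most the cardinality
  of the continuum, and so its structure can be transported to a subset of this type. The vector
  space operations and the inner product are not tied to those of \<open>complex\<close>.
\<close>

type_synonym ambient = "nat \<Rightarrow> complex"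

end

theory Submission
  imports Defs "HOL-Real_Asymp.Real_Asymp"
begin

text \<open>
  The Cayley transform sends \<open>z\<close> to a point \<open>a\<close> of the unit disc and turns the divergence
  \<open>ln (|z - cnj w|\<^sup>2 / (4 Im z Im w))\<close> into
  \<open>2 ln |1 - a * cnj b| - ln (1 - |a|\<^sup>2) - ln (1 - |b|\<^sup>2)\<close>. Expanding the logarithms gives
  \<open>\<Sum>n. |a\<^sup>n - b\<^sup>n|\<^sup>2 / n\<close>, so the powers \<open>a\<^sup>n / sqrt n\<close> embed the half-plane into
  the complex \<open>l\<^sup>2\<close>, which is regarded as a real Hilbert space.

  For the divergence itself, let \<open>\<zeta> x = (x - z) / (x - cnj z)\<close>, which maps the line to the unit
  circle. The density ratio is a constant times \<open>|1 - c * \<zeta> x|\<^sup>2\<close> with \<open>|c| < 1\<close>, and since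
  \<open>p\<^sub>z = \<zeta>' / (2 \<pi> \<i> \<zeta>)\<close>, every \<open>p\<^sub>z * \<zeta>\<^sup>n\<close> with \<open>n > 0\<close> has the antiderivative
  \<open>\<zeta>\<^sup>n / (2 \<pi> \<i> n)\<close>, whose limits at both ends of the line agree. Hence only the constant
  contributes to the integral.
\<close>

section \<open>Square-summable sequences\<close>

definition square_summable :: "(nat \<Rightarrow> 'a::real_normed_vector) set" where
  "square_summable = {f. summable (\<lambda>n. (norm (f n))\<^sup>2)}"

text \<open>For complex sequences the summand is the real part of \<open>f n * cnj (g n)\<close>, so
  this is the real part of the Hermitian product and turns complex \<open>l2\<close> into a real
  Hilbert space.\<close>

definition l2_inner :: "(nat \<Rightarrow> 'a::real_inner) \<Rightarrow> (nat \<Rightarrow> 'a) \<Rightarrow> real" where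
  "l2_inner f g = (\<Sum>n. f n \<bullet> g n)"

lemma square_summable_zero: "(\<lambda>n. 0) \<in> square_summable"
  by (simp add: square_summable_def)

lemma square_summable_scaleR:
  assumes "f \<in> square_summable"
  shows "(\<lambda>n. a *\<^sub>R f n) \<in> square_summable"
  using assms by (simp add: square_summable_def power_mult_distrib summable_mult)

lemma square_summable_add:
  assumes "f \<in> square_summable" "g \<in> square_summable"
  shows "(\<lambda>n. f n + g n) \<in> square_summable"
proof -
  have "norm ((norm (f n + g n))\<^sup>2) \<le> 2 * (norm (f n))\<^sup>2 + 2 * (norm (g n))\<^sup>2" for n
  proof -
    have "(norm (f n + g n))\<^sup>2 \<le> (norm (f n) + norm (g n))\<^sup>2"
      by (intro power_mono norm_triangle_ineq norm_ge_zero)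
    also have "\<dots> \<le> 2 * (norm (f n))\<^sup>2 + 2 * (norm (g n))\<^sup>2"
      using sum_squares_bound[of "norm (f n)" "norm (g n)"] by (simp add: power2_sum)
    finally show ?thesis by simp
  qed
  moreover have "summable (\<lambda>n. 2 * (norm (f n))\<^sup>2 + 2 * (norm (g n))\<^sup>2)"
    using assms by (intro summable_add summable_mult) (auto simp: square_summable_def)
  ultimately have "summable (\<lambda>n. (norm (f n + g n))\<^sup>2)"
    by (metis (no_types, lifting) summable_comparison_test')
  then show ?thesis
    by (simp add: square_summable_def)
qed

lemma square_summable_diff:
  assumes "f \<in> square_summable" "g \<in> square_summable"
  shows "(\<lambda>n. f n - g n) \<in> square_summable"
  using square_summable_add[OF assms(1) square_summable_scaleR[OF assms(2), of "-1"]] by simp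

lemma summable_inner_square_summable:
  fixes f g :: "nat \<Rightarrow> 'a::real_inner"
  assumes "f \<in> square_summable" "g \<in> square_summable"
  shows "summable (\<lambda>n. f n \<bullet> g n)"
proof (rule summable_comparison_test'[where g = "\<lambda>n. (norm (f n))\<^sup>2 + (norm (g n))\<^sup>2" and N = 0])
  show "summable (\<lambda>n. (norm (f n))\<^sup>2 + (norm (g n))\<^sup>2)"
    using assms by (auto simp: square_summable_def intro: summable_add)
  show "norm (f n \<bullet> g n) \<le> (norm (f n))\<^sup>2 + (norm (g n))\<^sup>2" for n
  proof -
    have "norm (f n \<bullet> g n) \<le> norm (f n) * norm (g n)"
      by (simp add: Cauchy_Schwarz_ineq2)
    also have "\<dots> \<le> (norm (f n))\<^sup>2 + (norm (g n))\<^sup>2"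
      using sum_squares_bound[of "norm (f n)" "norm (g n)"]
        mult_nonneg_nonneg[OF norm_ge_zero norm_ge_zero, of "f n" "g n"] by linarith
    finally show ?thesis .
  qed
qed

lemma l2_inner_self: "l2_inner f f = (\<Sum>n. (norm (f n))\<^sup>2)"
  by (simp only: l2_inner_def power2_norm_eq_inner)

lemma sum_le_l2_inner_self:
  assumes "f \<in> square_summable" "finite A"
  shows "(\<Sum>n\<in>A. (norm (f n))\<^sup>2) \<le> l2_inner f f"
  using assms unfolding l2_inner_self square_summable_def by (intro sum_le_suminf) auto

lemma l2_inner_self_nonneg:
  assumes "f \<in> square_summable"
  shows "0 \<le> l2_inner f f"
  using sum_le_l2_inner_self[OF assms, of "{}"] by simp

text \<open>Coordinates are controlled by the norm. This yields both the coordinatewise limits in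
  \<open>l2_complete\<close> and the definiteness of the inner product.\<close>

lemma norm_le_l2_norm:
  assumes "f \<in> square_summable"
  shows "norm (f n) \<le> hilbert_norm l2_inner f"
  using sum_le_l2_inner_self[OF assms, of "{n}"]
  by (simp add: hilbert_norm_def real_le_rsqrt)

lemma hilbert_diff_pointwise:
  "hilbert_diff (\<lambda>f g n. f n + g n) (\<lambda>a f n. a *\<^sub>R f n) f g = (\<lambda>n. f n - g n :: 'a::real_vector)"
  by (simp add: hilbert_diff_def)

lemma l2_complete:
  fixes s :: "nat \<Rightarrow> nat \<Rightarrow> 'a::{real_inner, complete_space}"
  assumes s: "\<And>n. s n \<in> square_summable"
    and cauchy: "\<And>e. e > 0 \<Longrightarrow>
      \<exists>N. \<forall>m\<ge>N. \<forall>n\<ge>N. hilbert_norm l2_inner (\<lambda>k. s m k - s n k) < e"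
  shows "\<exists>g\<in>square_summable. (\<lambda>n. hilbert_norm l2_inner (\<lambda>k. s n k - g k)) \<longlonglongrightarrow> 0"
proof -
  note diff = square_summable_diff[OF s s]
  have "Cauchy (\<lambda>n. s n k)" for k
  proof (rule metric_CauchyI)
    fix e :: real assume "e > 0"
    from cauchy[OF this] obtain N where
      N: "\<And>m n. m \<ge> N \<Longrightarrow> n \<ge> N \<Longrightarrow> hilbert_norm l2_inner (\<lambda>k. s m k - s n k) < e"
      by blast
    show "\<exists>N. \<forall>m\<ge>N. \<forall>n\<ge>N. dist (s m k) (s n k) < e"
      unfolding dist_norm
    proof (intro exI allI impI)
      fix m n assume "N \<le> m" "N \<le> n"
      then show "norm (s m k - s n k) < e"
        using le_less_trans[OF norm_le_l2_norm[OF diff[of m n], of k] N] by simp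
    qed
  qed
  then have "\<exists>l. (\<lambda>n. s n k) \<longlonglongrightarrow> l" for k
    by (simp add: Cauchy_convergent_iff convergent_def)
  then obtain g where g: "\<And>k. (\<lambda>n. s n k) \<longlonglongrightarrow> g k"
    by metis
  have tail: "\<exists>N. \<forall>m\<ge>N. (\<lambda>k. s m k - g k) \<in> square_summable \<and>
      hilbert_norm l2_inner (\<lambda>k. s m k - g k) \<le> e" if "e > 0" for e
  proof -
    from cauchy[OF that] obtain N where
      N: "\<And>m n. m \<ge> N \<Longrightarrow> n \<ge> N \<Longrightarrow> hilbert_norm l2_inner (\<lambda>k. s m k - s n k) < e"
      by blast
    \<comment> \<open>With only finitely many terms the limit in n may be taken termwise. The bound
      is uniform in K, so it then passes to the whole series.\<close>
    have partial: "(\<Sum>k<K. (norm (s m k - g k))\<^sup>2) \<le> e\<^sup>2" if m: "m \<ge> N" for m K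
    proof (rule LIMSEQ_le_const2)
      show "(\<lambda>n. \<Sum>k<K. (norm (s m k - s n k))\<^sup>2) \<longlonglongrightarrow> (\<Sum>k<K. (norm (s m k - g k))\<^sup>2)"
        by (intro tendsto_intros g)
      have "(\<Sum>k<K. (norm (s m k - s n k))\<^sup>2) \<le> e\<^sup>2" if "n \<ge> N" for n
      proof -
        have "(\<Sum>k<K. (norm (s m k - s n k))\<^sup>2) \<le> (hilbert_norm l2_inner (\<lambda>k. s m k - s n k))\<^sup>2"
          using sum_le_l2_inner_self[OF diff, of "{..<K}" m n]
            l2_inner_self_nonneg[OF diff, of m n] by (simp add: hilbert_norm_def)
        also have "\<dots> \<le> e\<^sup>2"
          using N[OF m that] l2_inner_self_nonneg[OF diff, of m n]
          by (intro power_mono) (auto simp: hilbert_norm_def)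
        finally show ?thesis .
      qed
      then show "\<exists>N. \<forall>n\<ge>N. (\<Sum>k<K. (norm (s m k - s n k))\<^sup>2) \<le> e\<^sup>2"
        by blast
    qed
    have "(\<lambda>k. s m k - g k) \<in> square_summable \<and> hilbert_norm l2_inner (\<lambda>k. s m k - g k) \<le> e"
      if m: "m \<ge> N" for m
    proof -
      have sq: "summable (\<lambda>k. (norm (s m k - g k))\<^sup>2)"
        by (rule summableI_nonneg_bounded[OF _ partial[OF m]]) simp
      have "l2_inner (\<lambda>k. s m k - g k) (\<lambda>k. s m k - g k) \<le> e\<^sup>2"
        unfolding l2_inner_self by (rule suminf_le_const[OF sq partial[OF m]])
      with sq \<open>e > 0\<close> show ?thesis
        by (simp add: square_summable_def hilbert_norm_def real_le_lsqrt)
    qed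
    then show ?thesis by blast
  qed
  have "g \<in> square_summable"
  proof -
    \<comment> \<open>The limit is recovered as \<open>s N - (s N - g)\<close>, a difference of two
      square-summable sequences.\<close>
    from tail[of 1] obtain N where "(\<lambda>k. s N k - g k) \<in> square_summable"
      by auto
    from square_summable_diff[OF s[of N] this] show ?thesis by simp
  qed
  moreover have "(\<lambda>n. hilbert_norm l2_inner (\<lambda>k. s n k - g k)) \<longlonglongrightarrow> 0"
  proof (rule LIMSEQ_I)
    fix r :: real assume "r > 0"
    \<comment> \<open>Halving r turns the weak inequality of \<open>tail\<close> into a strict
      one.\<close>
    then obtain N where N: "\<And>m. m \<ge> N \<Longrightarrow> (\<lambda>k. s m k - g k) \<in> square_summable"
        "\<And>m. m \<ge> N \<Longrightarrow> hilbert_norm l2_inner (\<lambda>k. s m k - g k) \<le> r / 2"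
      using tail[of "r / 2"] by auto
    have "norm (hilbert_norm l2_inner (\<lambda>k. s n k - g k) - 0) < r" if "n \<ge> N" for n
      using N(2)[OF that] l2_inner_self_nonneg[OF N(1)[OF that]] \<open>r > 0\<close>
      by (simp add: hilbert_norm_def)
    then show "\<exists>N. \<forall>n\<ge>N. norm (hilbert_norm l2_inner (\<lambda>k. s n k - g k) - 0) < r"
      by blast
  qed
  ultimately show ?thesis
    by (intro bexI[of _ g])
qed

lemma real_hilbert_space_l2:
  "real_hilbert_space (square_summable :: (nat \<Rightarrow> 'a::{real_inner, complete_space}) set)
     (\<lambda>n. 0) (\<lambda>f g n. f n + g n) (\<lambda>a f n. a *\<^sub>R f n) l2_inner"
proof (rule real_hilbert_space.intro, goal_cases)
  \<comment> \<open>Case numbers count the locale assumptions: 12 to 16 are the inner product axioms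
    and 17 is completeness. The vector space axioms hold coordinatewise and are left to the closing
    \<open>simp_all\<close>.\<close>
  case (12 f g)
  show ?case by (simp add: l2_inner_def inner_commute)
next
  case (13 f g h)
  then show ?case
    by (simp add: l2_inner_def inner_add_left suminf_add summable_inner_square_summable)
next
  case (14 f g a)
  then show ?case
    by (simp add: l2_inner_def suminf_mult summable_inner_square_summable)
next
  case (15 f)
  then show ?case by (rule l2_inner_self_nonneg)
next
  case (16 f)
  then have "norm (f n) \<le> 0" for n
    using norm_le_l2_norm[of f n] by (simp add: hilbert_norm_def)
  then show ?case by (simp add: fun_eq_iff)
next
  case (17 s)
  then show ?case
    unfolding hilbert_diff_pointwise by (rule l2_complete)
qed (simp_all add: square_summable_zero square_summable_add square_summable_scaleR
      scaleR_add_right scaleR_add_left ac_simps)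

section \<open>The logarithmic kernel on the unit disc\<close>

text \<open>Real part of the power series of \<open>Ln (1 - u)\<close>, because the real part of
  \<open>Ln\<close> is \<open>ln\<close> of the modulus. Starting at n = 0 is harmless: division by
  zero makes that term 0.\<close>

lemma sums_neg_ln_norm_one_minus:
  fixes u :: complex
  assumes "cmod u < 1"
  shows "(\<lambda>n. Re (u ^ n) / n) sums - ln (cmod (1 - u))"
proof -
  have "(\<lambda>n. Re (- (u ^ n / of_nat n))) sums Re (Ln (1 - u))"
    using Ln_series'[of "- u"] assms by (intro sums_Re) simp
  moreover have "1 - u \<noteq> 0"
    using assms by auto
  ultimately show ?thesis
    using sums_minus by (fastforce simp: Re_divide_of_nat)
qed

text \<open>Three instances of the preceding series, at \<open>a * cnj a\<close>,
  \<open>b * cnj b\<close> and \<open>a * cnj b\<close>, supply the squares and the cross term of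
  the expanded summand. At the first two arguments, which are real and below 1, the modulus of 1
  minus the argument is that number itself.\<close>

lemma disc_kernel_sums:
  fixes a b :: complex
  assumes "cmod a < 1" "cmod b < 1"
  shows "(\<lambda>n. (cmod (a ^ n /\<^sub>R sqrt n - b ^ n /\<^sub>R sqrt n))\<^sup>2) sums
    ln ((cmod (1 - a * cnj b))\<^sup>2 / ((1 - (cmod a)\<^sup>2) * (1 - (cmod b)\<^sup>2)))"
proof -
  have sq: "(cmod x)\<^sup>2 < 1" if "cmod x < 1" for x
    using that by (simp add: power_less_one_iff)
  have self: "(\<lambda>n. (cmod (x ^ n))\<^sup>2 / n) sums - ln (1 - (cmod x)\<^sup>2)" if "cmod x < 1" for x
  proof -
    have "cmod (1 - x * cnj x) = 1 - (cmod x)\<^sup>2"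
      using sq[OF that] unfolding complex_norm_square[symmetric]
      by (metis abs_of_pos diff_gt_0_iff_gt norm_of_real of_real_1 of_real_diff)
    moreover have "Re ((x * cnj x) ^ n) = (cmod (x ^ n))\<^sup>2" for n
      unfolding complex_norm_square[symmetric]
      by (metis Re_complex_of_real norm_power of_real_power power_mult mult.commute)
    ultimately show ?thesis
      using sums_neg_ln_norm_one_minus[of "x * cnj x"] sq[OF that]
      by (simp add: norm_mult power2_eq_square)
  qed
  have ab: "cmod (a * cnj b) < 1"
    using mult_strict_mono[OF assms] assms by (simp add: norm_mult)
  then have ab0: "0 < cmod (1 - a * cnj b)"
    by auto
  have "(\<lambda>n. (cmod (a ^ n))\<^sup>2 / n + (cmod (b ^ n))\<^sup>2 / n - 2 * (Re ((a * cnj b) ^ n) / n)) sums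
      (- ln (1 - (cmod a)\<^sup>2) + - ln (1 - (cmod b)\<^sup>2) - 2 * - ln (cmod (1 - a * cnj b)))"
    by (intro sums_add sums_diff sums_mult self assms sums_neg_ln_norm_one_minus ab)
  also have "- ln (1 - (cmod a)\<^sup>2) + - ln (1 - (cmod b)\<^sup>2) - 2 * - ln (cmod (1 - a * cnj b)) =
      ln ((cmod (1 - a * cnj b))\<^sup>2 / ((1 - (cmod a)\<^sup>2) * (1 - (cmod b)\<^sup>2)))"
    using sq[OF assms(1)] sq[OF assms(2)] ab0 by (simp add: ln_div ln_mult ln_realpow)
  also have "(\<lambda>n. (cmod (a ^ n))\<^sup>2 / n + (cmod (b ^ n))\<^sup>2 / n - 2 * (Re ((a * cnj b) ^ n) / n)) =
      (\<lambda>n. (cmod (a ^ n /\<^sub>R sqrt n - b ^ n /\<^sub>R sqrt n))\<^sup>2)"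
  proof
    fix n :: nat
    \<comment> \<open>Squaring the weight gives 1/n; at n = 0 both sides are 0 by the conventions
      for division and inverse.\<close>
    have "(cmod (a ^ n /\<^sub>R sqrt n - b ^ n /\<^sub>R sqrt n))\<^sup>2 = (cmod (a ^ n - b ^ n))\<^sup>2 / n"
      by (simp add: scaleR_diff_right[symmetric] power_mult_distrib divide_inverse power_inverse)
    also have "(cmod (a ^ n - b ^ n))\<^sup>2 =
        (cmod (a ^ n))\<^sup>2 + (cmod (b ^ n))\<^sup>2 - 2 * Re (a ^ n * cnj (b ^ n))"
      unfolding cmod_power2 by (simp add: power2_eq_square algebra_simps del: complex_cnj_power)
    finally show "(cmod (a ^ n))\<^sup>2 / n + (cmod (b ^ n))\<^sup>2 / n - 2 * (Re ((a * cnj b) ^ n) / n) =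
        (cmod (a ^ n /\<^sub>R sqrt n - b ^ n /\<^sub>R sqrt n))\<^sup>2"
      by (simp add: power_mult_distrib add_divide_distrib diff_divide_distrib)
  qed
  finally show ?thesis .
qed

text \<open>The case b = 0 of the kernel series: \<open>0 ^ n\<close> is nonzero only at n = 0,
  where the weight vanishes.\<close>

lemma square_summable_disc:
  fixes a :: complex
  assumes "cmod a < 1"
  shows "(\<lambda>n. a ^ n /\<^sub>R sqrt n) \<in> square_summable"
proof -
  have "(cmod (a ^ n /\<^sub>R sqrt n - 0 ^ n /\<^sub>R sqrt n))\<^sup>2 = (cmod (a ^ n /\<^sub>R sqrt n))\<^sup>2" for n
    by (cases n) auto
  then show ?thesis
    using disc_kernel_sums[OF assms, of 0] by (auto simp: square_summable_def sums_iff)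
qed

section \<open>From the half-plane to the disc by the Cayley transform\<close>

definition cayley :: "complex \<Rightarrow> complex" where
  "cayley z = (z - \<i>) / (z + \<i>)"

lemma cmod_plus_i_pos: "Im z > 0 \<Longrightarrow> 0 < cmod (z + \<i>)"
  by (auto simp: complex_eq_iff)

text \<open>Serves twice: its positivity places \<open>cayley z\<close> in the disc, and it
  evaluates the denominators in \<open>cayley_kernel\<close>.\<close>

lemma one_minus_cmod_cayley:
  assumes "Im z > 0"
  shows "1 - (cmod (cayley z))\<^sup>2 = 4 * Im z / (cmod (z + \<i>))\<^sup>2"
proof -
  have "(cmod (z + \<i>))\<^sup>2 - (cmod (z - \<i>))\<^sup>2 = 4 * Im z"
    unfolding cmod_power2 by (simp add: power2_eq_square algebra_simps)
  moreover have "1 - (cmod (cayley z))\<^sup>2 =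
      ((cmod (z + \<i>))\<^sup>2 - (cmod (z - \<i>))\<^sup>2) / (cmod (z + \<i>))\<^sup>2"
    using cmod_plus_i_pos[OF assms]
    by (simp add: cayley_def norm_divide power_divide diff_divide_distrib[of "_\<^sup>2"])
  ultimately show ?thesis by simp
qed

lemma cmod_cayley_less_1:
  assumes "Im z > 0"
  shows "cmod (cayley z) < 1"
proof -
  have "(cmod (cayley z))\<^sup>2 < 1\<^sup>2"
    using one_minus_cmod_cayley[OF assms] assms cmod_plus_i_pos[OF assms]
    by (smt (verit) divide_pos_pos one_power2 zero_less_power)
  then show ?thesis
    by (rule power2_less_imp_less) simp
qed

text \<open>The squares of \<open>cmod (z + \<i>)\<close> and \<open>cmod (w + \<i>)\<close> appear
  in both numerator and denominator and cancel.\<close>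

lemma cayley_kernel:
  assumes z: "Im z > 0" and w: "Im w > 0"
  shows "(cmod (1 - cayley z * cnj (cayley w)))\<^sup>2 /
      ((1 - (cmod (cayley z))\<^sup>2) * (1 - (cmod (cayley w))\<^sup>2)) =
    (cmod (z - cnj w))\<^sup>2 / (4 * Im z * Im w)"
proof -
  have nz: "z + \<i> \<noteq> 0" "cnj w - \<i> \<noteq> 0"
    using z w by (auto simp: complex_eq_iff)
  have "1 - cayley z * cnj (cayley w) = - 2 * \<i> * (z - cnj w) / ((z + \<i>) * cnj (w + \<i>))"
  proof -
    have "1 - cayley z * cnj (cayley w) =
        ((z + \<i>) * (cnj w - \<i>) - (z - \<i>) * (cnj w + \<i>)) / ((z + \<i>) * (cnj w - \<i>))"
      using nz by (simp add: cayley_def diff_divide_distrib[of "_ * _" "_ * _"])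
    also have "(z + \<i>) * (cnj w - \<i>) - (z - \<i>) * (cnj w + \<i>) = - 2 * \<i> * (z - cnj w)"
      by (simp add: algebra_simps)
    finally show ?thesis by simp
  qed
  then have eq: "cmod (1 - cayley z * cnj (cayley w)) =
      2 * cmod (z - cnj w) / (cmod (z + \<i>) * cmod (w + \<i>))"
    by (simp only: norm_mult norm_divide complex_mod_cnj) simp
  show ?thesis
    unfolding eq one_minus_cmod_cayley[OF z] one_minus_cmod_cayley[OF w]
    using z w cmod_plus_i_pos[OF z] cmod_plus_i_pos[OF w]
    by (simp add: power_divide power_mult_distrib divide_simps)
qed

section \<open>The divergence of two Cauchy densities\<close>

lemma of_real_neq_cnj_upper: "Im z > 0 \<Longrightarrow> complex_of_real x - cnj z \<noteq> 0"
  by (auto simp: complex_eq_iff)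

lemma of_real_neq_upper: "Im z > 0 \<Longrightarrow> complex_of_real x - z \<noteq> 0"
  by (auto simp: complex_eq_iff)

lemma cmod_of_real_diff_cnj: "cmod (of_real x - cnj z) = cmod (of_real x - z)"
  by (metis complex_cnj_complex_of_real complex_cnj_diff complex_mod_cnj)

lemma cauchy_density_pos: "Im z > 0 \<Longrightarrow> 0 < cauchy_density z x"
  using of_real_neq_upper[of z x] by (simp add: cauchy_density_def)

lemma continuous_cauchy_density:
  assumes "Im z > 0"
  shows "isCont (cauchy_density z) x"
  unfolding cauchy_density_def using of_real_neq_upper[OF assms, of x]
  by (intro continuous_intros) auto

text \<open>The antiderivative \<open>?F\<close> is the Cauchy distribution function minus 1/2. As
  the density is nonnegative, the fundamental theorem delivers integrability together with the value
  1/2 - (-1/2).\<close>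

lemma
  assumes z: "Im z > 0"
  shows integrable_cauchy_density: "integrable lborel (cauchy_density z)"
    and integral_cauchy_density: "integral\<^sup>L lborel (cauchy_density z) = 1"
proof -
  let ?F = "\<lambda>x. arctan ((x - Re z) / Im z) / pi"
  have deriv: "DERIV ?F x :> cauchy_density z x" for x
  proof -
    have nz: "(Im z)\<^sup>2 + (x - Re z)\<^sup>2 \<noteq> 0"
      using z by (simp add: sum_power2_eq_zero_iff)
    have sq: "1 + ((x - Re z) / Im z)\<^sup>2 = ((Im z)\<^sup>2 + (x - Re z)\<^sup>2) / (Im z)\<^sup>2"
      using z by (simp add: power_divide field_simps)
    have "inverse (1 + ((x - Re z) / Im z)\<^sup>2) * (1 / Im z) / pi = cauchy_density z x"
      unfolding sq cauchy_density_def cmod_power2 using z nz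
      by (simp add: field_simps power2_eq_square)
    moreover have "DERIV ?F x :> inverse (1 + ((x - Re z) / Im z)\<^sup>2) * (1 / Im z) / pi"
      using z by (auto intro!: derivative_eq_intros)
    ultimately show ?thesis by simp
  qed
  have top: "(?F \<longlongrightarrow> (pi / 2) / pi) at_top"
    using z by real_asymp
  have bot: "(?F \<longlongrightarrow> (- (pi / 2)) / pi) at_bot"
    using z by real_asymp
  have lim: "((?F \<circ> real_of_ereal) \<longlongrightarrow> - (1 / 2)) (at_right (-\<infinity>))"
       "((?F \<circ> real_of_ereal) \<longlongrightarrow> 1 / 2) (at_left \<infinity>)"
    using top bot by (simp_all add: ereal_tendsto_simps)
  have nonneg: "AE x in lborel. -\<infinity> < ereal x \<longrightarrow> ereal x < \<infinity> \<longrightarrow> 0 \<le> cauchy_density z x"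
    by (simp add: less_imp_le[OF cauchy_density_pos[OF z]])
  note FTC = interval_integral_FTC_nonneg[of "-\<infinity>" "\<infinity>" ?F "cauchy_density z",
      OF _ deriv continuous_cauchy_density[OF z] nonneg lim]
  show "integrable lborel (cauchy_density z)"
    using FTC(1) by (simp add: set_integrable_def)
  show "integral\<^sup>L lborel (cauchy_density z) = 1"
    using FTC(2) by (simp add: interval_lebesgue_integral_def set_lebesgue_integral_def)
qed

text \<open>The Moebius map of the upper half-plane onto the disc with \<open>z\<close> going to 0,
  restricted to the real line. Under it \<open>cauchy_density z\<close> corresponds to normalized
  arc length on the circle.\<close>

definition line_to_circle :: "complex \<Rightarrow> real \<Rightarrow> complex" where
  "line_to_circle z x = (of_real x - z) / (of_real x - cnj z)"

lemma norm_line_to_circle: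
  assumes "Im z > 0"
  shows "cmod (line_to_circle z x) = 1"
  using of_real_neq_upper[OF assms, of x]
  by (simp add: line_to_circle_def norm_divide cmod_of_real_diff_cnj)

lemma continuous_line_to_circle:
  assumes "Im z > 0"
  shows "isCont (line_to_circle z) x"
  unfolding line_to_circle_def using of_real_neq_cnj_upper[OF assms, of x]
  by (intro continuous_intros) auto

lemma borel_measurable_line_to_circle:
  assumes "Im z > 0"
  shows "line_to_circle z \<in> borel_measurable borel"
  using continuous_line_to_circle[OF assms]
  by (intro borel_measurable_continuous_onI) (simp add: continuous_at_imp_continuous_on)

lemma integrable_cauchy_density_bounded:
  fixes f :: "real \<Rightarrow> complex"
  assumes z: "Im z > 0" and f: "f \<in> borel_measurable borel" and bound: "\<And>x. cmod (f x) \<le> B"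
  shows "integrable lborel (\<lambda>x. cauchy_density z x *\<^sub>R f x)"
proof (rule Bochner_Integration.integrable_bound)
  show "integrable lborel (\<lambda>x. B * cauchy_density z x)"
    using integrable_cauchy_density[OF z] by simp
  show "(\<lambda>x. cauchy_density z x *\<^sub>R f x) \<in> borel_measurable lborel"
    using borel_measurable_integrable[OF integrable_cauchy_density[OF z]] f by simp
  show "AE x in lborel. norm (cauchy_density z x *\<^sub>R f x) \<le> norm (B * cauchy_density z x)"
  proof (rule AE_I2)
    fix x
    have "0 \<le> B"
      using order_trans[OF norm_ge_zero bound] .
    then show "norm (cauchy_density z x *\<^sub>R f x) \<le> norm (B * cauchy_density z x)"
      using mult_left_mono[OF bound less_imp_le[OF cauchy_density_pos[OF z, of x]], of x]
        cauchy_density_pos[OF z, of x]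
      by (simp add: abs_mult mult.commute)
  qed
qed

lemma has_vector_derivative_line_to_circle_power:
  assumes z: "Im z > 0" and n: "n > 0"
  shows "((\<lambda>x. line_to_circle z x ^ n / (2 * pi * \<i> * n)) has_vector_derivative
    cauchy_density z x *\<^sub>R line_to_circle z x ^ n) (at x)"
proof -
  define p q where "p = complex_of_real x - z" and "q = complex_of_real x - cnj z"
  have nz: "p \<noteq> 0" "q \<noteq> 0"
    using of_real_neq_upper[OF z] of_real_neq_cnj_upper[OF z] by (auto simp: p_def q_def)
  have pq: "p * q = of_real ((cmod (of_real x - z))\<^sup>2)"
    unfolding complex_norm_square by (simp add: p_def q_def)
  have diff: "q - p = 2 * \<i> * Im z"
    by (simp add: p_def q_def complex_eq_iff)
  obtain m where m: "n = Suc m"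
    using n by (cases n) auto
  \<comment> \<open>The right-hand side is the logarithmic derivative of p / q, divided by
    \<open>2 * pi * \<i>\<close>.\<close>
  have dens: "complex_of_real (cauchy_density z x) = (q - p) / (2 * pi * \<i> * (p * q))"
    unfolding pq diff cauchy_density_def by (simp add: field_simps)
  \<comment> \<open>The derivative is computed in a complex variable t and afterwards restricted to
    the real line.\<close>
  have "((\<lambda>t. ((t - z) / (t - cnj z)) ^ n / (2 * pi * \<i> * n)) has_field_derivative
      (n * ((p / q) ^ m * ((q - p) / (q * q)))) / (2 * pi * \<i> * n)) (at (of_real x))"
  proof -
    have "((\<lambda>t. (t - z) / (t - cnj z)) has_field_derivative (q - p) / (q * q)) (at (of_real x))"
      using nz unfolding p_def q_def by (auto intro!: derivative_eq_intros)
    from DERIV_cdivide[OF DERIV_power[OF this, of n], of "2 * pi * \<i> * n"] show ?thesis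
      by (simp add: m p_def q_def mult_ac)
  qed
  then have "((\<lambda>x. line_to_circle z x ^ n / (2 * pi * \<i> * n)) has_vector_derivative
      (n * ((p / q) ^ m * ((q - p) / (q * q)))) / (2 * pi * \<i> * n)) (at x)"
    unfolding line_to_circle_def by (rule has_vector_derivative_real_field)
  also have "(n * ((p / q) ^ m * ((q - p) / (q * q)))) / (2 * pi * \<i> * n) =
      cauchy_density z x *\<^sub>R line_to_circle z x ^ n"
  proof -
    have "(n * (r * ((q - p) / (q * q)))) / (2 * pi * \<i> * n) =
        (q - p) / (2 * pi * \<i> * (p * q)) * (p / q * r)" for r
      using nz n by (simp add: divide_simps)
    then show ?thesis
      unfolding scaleR_conv_of_real dens line_to_circle_def p_def[symmetric] q_def[symmetric]
      by (simp add: m)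
  qed
  finally show ?thesis .
qed

text \<open>The map is 1 plus a constant over \<open>x - cnj z\<close>, so it tends to 1 whenever
  the modulus of x tends to infinity, whatever the sign.\<close>

lemma line_to_circle_tendsto:
  assumes "Im z > 0"
  shows "(line_to_circle z \<longlongrightarrow> 1) at_top" "(line_to_circle z \<longlongrightarrow> 1) at_bot"
proof -
  have eq: "line_to_circle z = (\<lambda>x. 1 + (cnj z - z) / (of_real x - cnj z))"
    using of_real_neq_cnj_upper[OF assms] by (auto simp: line_to_circle_def field_simps)
  have *: "(line_to_circle z \<longlongrightarrow> 1) F" if "filterlim (of_real :: real \<Rightarrow> complex) at_infinity F" for F
  proof -
    have "((\<lambda>x. 1 + (cnj z - z) / (of_real x + - cnj z)) \<longlongrightarrow> 1 + 0) F"
      by (intro tendsto_add tendsto_const tendsto_divide_0[OF tendsto_const]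
          tendsto_add_filterlim_at_infinity'[OF that tendsto_const])
    then show ?thesis by (simp add: eq)
  qed
  show "(line_to_circle z \<longlongrightarrow> 1) at_top" "(line_to_circle z \<longlongrightarrow> 1) at_bot"
    by (rule *, rule filterlim_norm_at_top_imp_at_infinity, simp, real_asymp)+
qed

lemma integral_line_to_circle_power:
  assumes z: "Im z > 0" and n: "n > 0"
  shows "(LINT x|lborel. cauchy_density z x *\<^sub>R line_to_circle z x ^ n) = 0"
proof -
  let ?F = "\<lambda>x. line_to_circle z x ^ n / (2 * pi * \<i> * n)"
  let ?f = "\<lambda>x. cauchy_density z x *\<^sub>R line_to_circle z x ^ n"
  \<comment> \<open>The integrand is complex, so the fundamental theorem needs integrability
    beforehand; it follows from domination by the density.\<close>
  have int: "integrable lborel ?f"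
    by (rule integrable_cauchy_density_bounded[OF z, where B = 1])
       (auto simp: norm_power norm_line_to_circle[OF z] borel_measurable_line_to_circle[OF z]
         intro!: borel_measurable_power)
  have lim: "((?F \<circ> real_of_ereal) \<longlongrightarrow> 1 ^ n / (2 * pi * \<i> * n)) (at_right (-\<infinity>))"
      "((?F \<circ> real_of_ereal) \<longlongrightarrow> 1 ^ n / (2 * pi * \<i> * n)) (at_left \<infinity>)"
    unfolding ereal_tendsto_simps
    by (intro tendsto_divide tendsto_power tendsto_const line_to_circle_tendsto[OF z]; use n in simp)+
  have "(LBINT x=-\<infinity>..\<infinity>. ?f x) = 1 ^ n / (2 * pi * \<i> * n) - 1 ^ n / (2 * pi * \<i> * n)"
    by (rule interval_integral_FTC_integrable[OF _ has_vector_derivative_line_to_circle_power[OF z n] _ _ lim])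
       (use int in \<open>auto simp: set_integrable_def
         intro!: continuous_intros continuous_line_to_circle[OF z] continuous_cauchy_density[OF z]\<close>)
  then show ?thesis
    by (simp add: interval_lebesgue_integral_def set_lebesgue_integral_def)
qed

text \<open>A mean value property: \<open>Ln (1 - c * u)\<close> is holomorphic near the closed unit
  disc and vanishes at u = 0. The proof integrates the power series term by term, which is allowed
  because the n-th term has norm \<open>cauchy_density z x * (cmod c ^ n / n)\<close> and these are
  summable in integral.\<close>

lemma
  assumes z: "Im z > 0" and c: "cmod c < 1"
  defines "g \<equiv> \<lambda>x. cauchy_density z x *\<^sub>R Ln (1 - c * line_to_circle z x)"
  shows integrable_Ln_line_to_circle: "integrable lborel g"
    and integral_Ln_line_to_circle: "integral\<^sup>L lborel g = 0"
proof -
  let ?f = "\<lambda>n x. cauchy_density z x *\<^sub>R (- ((c * line_to_circle z x) ^ n / of_nat n))"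
  have series: "(\<lambda>n. ?f n x) sums g x" for x
    using Ln_series'[of "- (c * line_to_circle z x)"] c
    unfolding g_def by (intro sums_scaleR_right) (simp add: norm_mult norm_line_to_circle[OF z])
  have int: "integrable lborel (?f n)" for n
    by (rule integrable_cauchy_density_bounded[OF z, where B = "cmod c ^ n / n"])
       (auto simp: norm_power norm_mult norm_divide norm_line_to_circle[OF z]
         borel_measurable_line_to_circle[OF z] intro!: borel_measurable_power borel_measurable_times
         borel_measurable_uminus borel_measurable_divide)
  have norm: "norm (?f n x) = cauchy_density z x * (cmod c ^ n / n)" for n x
    using cauchy_density_pos[OF z, of x]
    by (simp add: norm_power norm_mult norm_divide norm_line_to_circle[OF z])
  have geom: "summable (\<lambda>n. cmod c ^ n / n)"
  proof (rule summable_comparison_test'[where N = 1])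
    show "summable (\<lambda>n. cmod c ^ n)"
      using c by (simp add: summable_geometric)
    show "norm (cmod c ^ n / n) \<le> cmod c ^ n" if "n \<ge> 1" for n
      using that by (simp add: norm_power divide_le_eq mult_le_cancel_left1)
  qed
  have AE: "AE x in lborel. summable (\<lambda>n. norm (?f n x))"
    unfolding norm by (intro AE_I2 summable_mult geom)
  have sum: "summable (\<lambda>n. LINT x|lborel. norm (?f n x))"
    unfolding norm using geom by (simp add: integral_cauchy_density[OF z])
  have g: "g = (\<lambda>x. \<Sum>n. ?f n x)"
    using series by (auto simp: sums_iff)
  show "integrable lborel g"
    unfolding g by (rule integrable_suminf[OF int AE sum])
  have zero: "(LINT x|lborel. ?f n x) = 0" for n
  \<comment> \<open>At n = 0 the coefficient is 0 by division by zero, so only positive powers have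
    to be integrated.\<close>
  proof (cases "n = 0")
    case False
    have "(LINT x|lborel. ?f n x) =
        (LINT x|lborel. (- (c ^ n / n)) * (cauchy_density z x *\<^sub>R line_to_circle z x ^ n))"
      by (rule arg_cong[where f = "integral\<^sup>L lborel"])
         (auto simp: power_mult_distrib scaleR_conv_of_real)
    also have "\<dots> = (- (c ^ n / n)) * (LINT x|lborel. cauchy_density z x *\<^sub>R line_to_circle z x ^ n)"
      by (rule integral_mult_right_zero)
    finally show ?thesis
      using integral_line_to_circle_power[OF z] False by simp
  qed simp
  show "integral\<^sup>L lborel g = 0"
    unfolding g integral_suminf[OF int AE sum] zero by simp
qed

text \<open>The coefficient of \<open>line_to_circle z x\<close> is the conjugate of the image of
  \<open>w\<close> under the same Moebius map. This choice puts \<open>x - cnj w\<close> into the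
  numerator, and for real x its modulus equals that of \<open>x - w\<close>.\<close>

lemma cauchy_density_ratio:
  assumes z: "Im z > 0" and w: "Im w > 0"
  shows "cauchy_density z x / cauchy_density w x = (cmod (z - cnj w))\<^sup>2 / (4 * Im z * Im w) *
    (cmod (1 - cnj (z - w) / (z - cnj w) * line_to_circle z x))\<^sup>2"
proof -
  define p q where "p = complex_of_real x - z" and "q = complex_of_real x - cnj z"
  have nz: "p \<noteq> 0" "q \<noteq> 0" "z - cnj w \<noteq> 0"
    using of_real_neq_upper[OF z] of_real_neq_cnj_upper[OF z] z w
    by (auto simp: p_def q_def complex_eq_iff)
  have "1 - cnj (z - w) / (z - cnj w) * (p / q) =
      (of_real x - cnj w) * (z - cnj z) / ((z - cnj w) * q)"
    using nz by (simp add: field_simps) (simp add: p_def q_def algebra_simps)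
  moreover have "cmod (z - cnj z) = 2 * Im z"
    using z by (simp add: complex_diff_cnj norm_mult)
  ultimately have "cmod (1 - cnj (z - w) / (z - cnj w) * line_to_circle z x) =
      cmod (of_real x - w) * (2 * Im z) / (cmod (z - cnj w) * cmod (of_real x - z))"
    by (simp only: line_to_circle_def p_def q_def norm_mult norm_divide cmod_of_real_diff_cnj)
  moreover have "cmod (of_real x - z) \<noteq> 0" "cmod (of_real x - w) \<noteq> 0" "cmod (z - cnj w) \<noteq> 0"
    using of_real_neq_upper[OF z, of x] of_real_neq_upper[OF w, of x] nz by simp_all
  ultimately show ?thesis
    using z w unfolding cauchy_density_def
    by (simp only: power_divide power_mult_distrib) (simp add: divide_simps, simp add: power2_eq_square)
qed

theorem kl_div_cauchy_density:
  assumes z: "Im z > 0" and w: "Im w > 0"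
  shows "kl_div (cauchy_density z) (cauchy_density w) =
    ln ((cmod (z - cnj w))\<^sup>2 / (4 * Im z * Im w))"
proof -
  define c where "c = cnj (z - w) / (z - cnj w)"
  define K where "K = (cmod (z - cnj w))\<^sup>2 / (4 * Im z * Im w)"
  define h where "h = (\<lambda>x. cauchy_density z x *\<^sub>R Ln (1 - c * line_to_circle z x))"
  have nz: "z - cnj w \<noteq> 0"
    using z w by (auto simp: complex_eq_iff)
  then have K: "K > 0"
    using z w by (simp add: K_def)
  \<comment> \<open>The difference of the two squares is \<open>4 * Im z * Im w\<close>.\<close>
  have "(cmod (z - w))\<^sup>2 < (cmod (z - cnj w))\<^sup>2"
    using mult_pos_pos[OF z w] unfolding cmod_power2 by (simp add: power2_eq_square algebra_simps)
  then have "cmod (z - w) < cmod (z - cnj w)"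
    by (rule power2_less_imp_less) simp
  then have c: "cmod c < 1"
    using nz by (simp add: c_def norm_divide del: complex_cnj_diff)
  have h: "integrable lborel h" "integral\<^sup>L lborel h = 0"
    unfolding h_def by (fact integrable_Ln_line_to_circle[OF z c] integral_Ln_line_to_circle[OF z c])+
  have "cauchy_density z x * ln (cauchy_density z x / cauchy_density w x) =
      ln K * cauchy_density z x + 2 * Re (h x)" for x
  proof -
    have "cmod (c * line_to_circle z x) < 1"
      using c by (simp add: norm_mult norm_line_to_circle[OF z])
    then have "1 - c * line_to_circle z x \<noteq> 0"
      by auto
    then have "ln (cauchy_density z x / cauchy_density w x) =
        ln K + 2 * Re (Ln (1 - c * line_to_circle z x))"
      using K unfolding cauchy_density_ratio[OF z w] K_def[symmetric] c_def[symmetric]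
      by (simp add: ln_mult ln_realpow)
    then show ?thesis
      by (simp add: h_def algebra_simps)
  qed
  then have "kl_div (cauchy_density z) (cauchy_density w) =
      (LINT x|lborel. ln K * cauchy_density z x + 2 * Re (h x))"
    by (simp add: kl_div_def)
  \<comment> \<open>The density has total mass 1, and the real part of \<open>h\<close> integrates
    to 0.\<close>
  also have "\<dots> = ln K"
    using integrable_cauchy_density[OF z] integral_cauchy_density[OF z] h
    by (subst Bochner_Integration.integral_add) auto
  finally show ?thesis
    by (simp add: K_def)
qed

theorem theorem11:
  "\<exists>(H :: ambient set) zero add scl ip (\<phi> :: complex \<Rightarrow> ambient).
     real_hilbert_space H zero add scl ip \<and>
     \<phi> \<in> upper_half_plane \<rightarrow> H \<and>
     (\<forall>z \<in> upper_half_plane. \<forall>w \<in> upper_half_plane.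
        sqrt (kl_div (cauchy_density z) (cauchy_density w)) =
          hilbert_norm ip (hilbert_diff add scl (\<phi> z) (\<phi> w)))"
proof (intro exI conjI ballI)
  \<comment> \<open>The entry at \<open>n = 0\<close> vanishes, since \<open>inverse 0 = 0\<close>.\<close>
  let ?\<phi> = "\<lambda>z n. cayley z ^ n /\<^sub>R sqrt (real n)"
  show "real_hilbert_space (square_summable :: ambient set)
      (\<lambda>n. 0) (\<lambda>f g n. f n + g n) (\<lambda>a f n. a *\<^sub>R f n) l2_inner"
    by (rule real_hilbert_space_l2)
  show "?\<phi> \<in> upper_half_plane \<rightarrow> square_summable"
    by (auto simp: upper_half_plane_def intro!: square_summable_disc cmod_cayley_less_1)
  fix z w assume "z \<in> upper_half_plane" "w \<in> upper_half_plane"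
  then have zw: "Im z > 0" "Im w > 0"
    by (auto simp: upper_half_plane_def)
  \<comment> \<open>The kernel series at the two Cayley images and the divergence have the same
    closed form, matched through \<open>cayley_kernel\<close>.\<close>
  have "l2_inner (\<lambda>n. ?\<phi> z n - ?\<phi> w n) (\<lambda>n. ?\<phi> z n - ?\<phi> w n) =
      kl_div (cauchy_density z) (cauchy_density w)"
    using disc_kernel_sums[OF cmod_cayley_less_1[OF zw(1)] cmod_cayley_less_1[OF zw(2)]]
    unfolding l2_inner_self kl_div_cauchy_density[OF zw] cayley_kernel[OF zw] by (simp add: sums_iff)
  then show "sqrt (kl_div (cauchy_density z) (cauchy_density w)) =
      hilbert_norm l2_inner (hilbert_diff (\<lambda>f g n. f n + g n) (\<lambda>a f n. a *\<^sub>R f n) (?\<phi> z) (?\<phi> w))"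
    by (simp only: hilbert_diff_pointwise hilbert_norm_def)
qed

end
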